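(* Let $\mathcal X,\mathcal U,\mathcal S,\mathit\Theta$ be arbitrary measurable spaces, let $\mathbf P(X|\Theta):\mathit\Theta\dashrightarrow\mathcal X$ be a statistical model (Markov kernel) and let $R:\mathcal X\to\mathcal U$ and $S:\mathcal X\to\mathcal S$ be statistics (measurable maps) such that: 1. $R$ is ancillary: $R\perp\!\!\!\perp_{\mathbf P(X|\Theta)}\Theta$; 2. $S$ is sufficient: $X\perp\!\!\!\perp_{\mathbf P(X|\Theta)}\Theta\mid S$; 3. $S$ is boundedly complete for $\mathbf P(X|\Theta)$. Then $$R\perp\!\!\!\perp_{\mathbf P(X|\Theta)}\Theta,S.$$
   Context: A Markov kernel $\mathbf P(X|\Theta):\mathit\Theta\dashrightarrow\mathcal X$ assigns to each $\theta\in\mathit\Theta$ a probability measure $\mathbf P(X|\Theta=\theta)$ on $\mathcal X$ such that $\theta\mapsto\mathbf P(X\in A|\Theta=\theta)$ is measurable for every measurable $A$. Transitional conditional independence. On $\mathcal X\times\mathit\Theta$ consider measurable maps $F,G,H$ into measurable spaces $\mathcal F,\mathcal G,\mathcal H$; in particular the projections $X,\Theta$ and functions of $X$ such as $R=R(X)$, $S=S(X)$, and pairs such as $(\Theta,S)$. For each $\theta$ let $\mathbf P(F,G,H|\Theta=\theta)$ be the law of $(F,G,H)(x,\theta)$ for $x\sim\mathbf P(X|\Theta=\theta)$. Then $F\perp\!\!\!\perp_{\mathbf P(X|\Theta)}G\mid H$ means: there exists a Markov kernel $\mathbf Q(F|H):\mathcal H\dashrightarrow\mathcal F$ with $\mathbf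 P(F,G,H|\Theta)=\mathbf Q(F|H)\otimes\mathbf P(G,H|\Theta)$, i.e. for all $\theta$ and measurable $A,B,C$: $\mathbf P(F\in A,G\in B,H\in C|\Theta=\theta)=\int\mathbf 1_B(g)\mathbf 1_C(h)\,\mathbf Q(F\in A|H=h)\,\mathbf P((G,H)\in d(g,h)|\Theta=\theta)$. $F\perp\!\!\!\perp_{\mathbf P(X|\Theta)}G$ abbreviates the case where $H$ is the constant map to a one-point space, so that $\mathbf Q(F|H)$ is a single probability measure on $\mathcal F$. $R\perp\!\!\!\perp\Theta,S$ means $R\perp\!\!\!\perp(\Theta,S)$. $S$ is boundedly complete for $\mathbf P(X|\Theta)$ if for every bounded measurable $g:\mathcal S\to\mathbb R$: if $\int g(s)\,\mathbf P(S\in ds|\Theta=\theta)=0$ for all $\theta\in\mathit\Theta$, then for every $\theta\in\mathit\Theta$, $g=0$ holds $\mathbf P(S|\Theta=\theta)$-almost surely. *)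

theory Defs
  imports "HOL-Probability.Probability"
begin

text \<open>
  Membership in \<open>T \<rightarrow>\<^sub>M prob_algebra X\<close> says that every \<open>K \<theta>\<close> is a probability measure on \<open>X\<close>
  and that \<open>\<theta> \<mapsto> K \<theta> A\<close> is measurable for every measurable \<open>A\<close>.
\<close>

abbreviation markov_kernel :: "'t measure \<Rightarrow> 'x measure \<Rightarrow> ('t \<Rightarrow> 'x measure) \<Rightarrow> bool" where
  "markov_kernel T X K \<equiv> K \<in> T \<rightarrow>\<^sub>M prob_algebra X"

text \<open>The law of \<open>F(x, \<theta>)\<close> on the measurable space \<open>N\<close>, for \<open>x\<close> distributed as \<open>K \<theta>\<close>.\<close>

definition cond_law ::
  "('t \<Rightarrow> 'x measure) \<Rightarrow> 'f measure \<Rightarrow> ('x \<times> 't \<Rightarrow> 'f) \<Rightarrow> 't \<Rightarrow> 'f measure" where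
  "cond_law K N F \<theta> = distr (K \<theta>) N (\<lambda>x. F (x, \<theta>))"

text \<open>
  Transitional conditional independence of \<open>F\<close> from \<open>G\<close> given \<open>H\<close>, with values in the measurable
  spaces \<open>MF\<close>, \<open>MG\<close>, \<open>MH\<close>.  The notion is intended for \<open>K\<close> a Markov kernel from \<open>T\<close> to \<open>X\<close> and
  for \<open>F\<close>, \<open>G\<close>, \<open>H\<close> measurable on \<open>X \<Otimes>\<^sub>M T\<close>.  The kernel \<open>Q\<close> does not depend on \<open>\<theta>\<close>, and
  the notion is not symmetric in \<open>F\<close> and \<open>G\<close>.
\<close>

definition trans_cond_indep ::
  "'t measure \<Rightarrow> ('t \<Rightarrow> 'x measure) \<Rightarrow>
   'f measure \<Rightarrow> ('x \<times> 't \<Rightarrow> 'f) \<Rightarrow>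
   'g measure \<Rightarrow> ('x \<times> 't \<Rightarrow> 'g) \<Rightarrow>
   'h measure \<Rightarrow> ('x \<times> 't \<Rightarrow> 'h) \<Rightarrow> bool" where
  "trans_cond_indep T K MF F MG G MH H \<longleftrightarrow>
     (\<exists>Q. markov_kernel MH MF Q \<and>
       (\<forall>\<theta>\<in>space T. \<forall>A\<in>sets MF. \<forall>B\<in>sets MG. \<forall>C\<in>sets MH.
          emeasure (cond_law K (MF \<Otimes>\<^sub>M MG \<Otimes>\<^sub>M MH) (\<lambda>\<omega>. (F \<omega>, G \<omega>, H \<omega>)) \<theta>) (A \<times> B \<times> C) =
          (\<integral>\<^sup>+ (g, h). indicator B g * indicator C h * emeasure (Q h) A
             \<partial>cond_law K (MG \<Otimes>\<^sub>M MH) (\<lambda>\<omega>. (G \<omega>, H \<omega>)) \<theta>)))"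

abbreviation trans_indep ::
  "'t measure \<Rightarrow> ('t \<Rightarrow> 'x measure) \<Rightarrow>
   'f measure \<Rightarrow> ('x \<times> 't \<Rightarrow> 'f) \<Rightarrow>
   'g measure \<Rightarrow> ('x \<times> 't \<Rightarrow> 'g) \<Rightarrow> bool" where
  "trans_indep T K MF F MG G \<equiv>
     trans_cond_indep T K MF F MG G (count_space (UNIV :: unit set)) (\<lambda>_. ())"

definition boundedly_complete ::
  "'t measure \<Rightarrow> ('t \<Rightarrow> 'x measure) \<Rightarrow> 's measure \<Rightarrow> ('x \<times> 't \<Rightarrow> 's) \<Rightarrow> bool" where
  "boundedly_complete T K N S \<longleftrightarrow>
     (\<forall>g :: 's \<Rightarrow> real. g \<in> borel_measurable N \<longrightarrow> bounded (g ` space N) \<longrightarrow>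
        (\<forall>\<theta>\<in>space T. (\<integral>s. g s \<partial>cond_law K N S \<theta>) = 0) \<longrightarrow>
        (\<forall>\<theta>\<in>space T. AE s in cond_law K N S \<theta>. g s = 0))"

end

theory Submission
  imports Defs
begin

text \<open>
  This is Basu's theorem.  Let \<open>q\<close> be the common law of \<open>R\<close> under all parameters (ancillarity) and
  \<open>Q\<^sub>S\<close> the parameter-free conditional law of \<open>X\<close> given \<open>S\<close> (sufficiency).  Fix an event
  \<open>E = {R \<in> A}\<close>.  The function \<open>g s = Q\<^sub>S s E - q A\<close> of the sufficient statistic is bounded, does not
  involve the parameter, and has mean \<open>P\<^sub>\<theta> E - q A = 0\<close> under every \<open>\<theta>\<close>; so bounded completeness
  makes it vanish almost surely, that is, \<open>Q\<^sub>S (S x) E = q A\<close> for almost all \<open>x\<close>.  Integrating this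
  identity over \<open>{S \<in> D}\<close> gives \<open>P\<^sub>\<theta> (R \<in> A, S \<in> D) = q A * P\<^sub>\<theta> (S \<in> D)\<close>: the lemma
  \<open>basu_product_rule\<close>.

  Transitional independence from the pair \<open>(\<Theta>, S)\<close> asks for this product rule only at one
  parameter at a time.  Since the parameter is constant under \<open>P\<^sub>\<theta>\<close>, an event in \<open>(\<Theta>, S)\<close> is then
  the event \<open>S \<in> D\<close> for the section \<open>D\<close> at \<open>\<theta>\<close>, and the law \<open>q\<close> of \<open>R\<close> serves as the kernel.
\<close>

text \<open>
  The definition speaks of image laws on product spaces; pulled back to the sample space along the
  section at \<open>\<theta>\<close>, it becomes a statement about integrals against \<open>K \<theta>\<close> alone.
\<close>

lemma trans_cond_indep_iff_sample_space:
  assumes K: "markov_kernel T X K"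
    and F: "\<forall>\<theta>\<in>space T. (\<lambda>x. F (x, \<theta>)) \<in> X \<rightarrow>\<^sub>M MF"
    and G: "\<forall>\<theta>\<in>space T. (\<lambda>x. G (x, \<theta>)) \<in> X \<rightarrow>\<^sub>M MG"
    and H: "\<forall>\<theta>\<in>space T. (\<lambda>x. H (x, \<theta>)) \<in> X \<rightarrow>\<^sub>M MH"
  shows "trans_cond_indep T K MF F MG G MH H \<longleftrightarrow>
    (\<exists>Q. markov_kernel MH MF Q \<and>
      (\<forall>\<theta>\<in>space T. \<forall>A\<in>sets MF. \<forall>B\<in>sets MG. \<forall>C\<in>sets MH.
         emeasure (K \<theta>) {x \<in> space X. F (x, \<theta>) \<in> A \<and> G (x, \<theta>) \<in> B \<and> H (x, \<theta>) \<in> C} =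
         (\<integral>\<^sup>+ x. indicator B (G (x, \<theta>)) * indicator C (H (x, \<theta>)) * emeasure (Q (H (x, \<theta>))) A
            \<partial>K \<theta>)))"
proof -
  have law: "emeasure (cond_law K (MF \<Otimes>\<^sub>M MG \<Otimes>\<^sub>M MH) (\<lambda>\<omega>. (F \<omega>, G \<omega>, H \<omega>)) \<theta>) (A \<times> B \<times> C) =
      emeasure (K \<theta>) {x \<in> space X. F (x, \<theta>) \<in> A \<and> G (x, \<theta>) \<in> B \<and> H (x, \<theta>) \<in> C}"
    and int: "(\<integral>\<^sup>+ (g, h). indicator B g * indicator C h * emeasure (Q h) A
        \<partial>cond_law K (MG \<Otimes>\<^sub>M MH) (\<lambda>\<omega>. (G \<omega>, H \<omega>)) \<theta>) =
      (\<integral>\<^sup>+ x. indicator B (G (x, \<theta>)) * indicator C (H (x, \<theta>)) * emeasure (Q (H (x, \<theta>))) A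
        \<partial>K \<theta>)"
    if Q: "markov_kernel MH MF Q" and \<theta>: "\<theta> \<in> space T"
      and A: "A \<in> sets MF" and B: "B \<in> sets MG" and C: "C \<in> sets MH" for Q \<theta> A B C
  proof -
    have sets_K: "sets (K \<theta>) = sets X"
      using measurable_space[OF K \<theta>] by (simp add: space_prob_algebra)
    have [measurable]: "(\<lambda>x. F (x, \<theta>)) \<in> K \<theta> \<rightarrow>\<^sub>M MF" "(\<lambda>x. G (x, \<theta>)) \<in> K \<theta> \<rightarrow>\<^sub>M MG"
        "(\<lambda>x. H (x, \<theta>)) \<in> K \<theta> \<rightarrow>\<^sub>M MH"
      using bspec[OF F \<theta>] bspec[OF G \<theta>] bspec[OF H \<theta>]
      by (simp_all add: measurable_cong_sets[OF sets_K refl])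
    note [measurable] = A B C
    have "Q \<in> MH \<rightarrow>\<^sub>M subprob_algebra MF"
      using Q by (rule measurable_prob_algebraD)
    then have [measurable]: "(\<lambda>h. emeasure (Q h) A) \<in> borel_measurable MH"
      using A by (rule measurable_emeasure_kernel)
    show "emeasure (cond_law K (MF \<Otimes>\<^sub>M MG \<Otimes>\<^sub>M MH) (\<lambda>\<omega>. (F \<omega>, G \<omega>, H \<omega>)) \<theta>) (A \<times> B \<times> C) =
        emeasure (K \<theta>) {x \<in> space X. F (x, \<theta>) \<in> A \<and> G (x, \<theta>) \<in> B \<and> H (x, \<theta>) \<in> C}"
      unfolding cond_law_def
      by (subst emeasure_distr)
         (auto simp: sets_eq_imp_space_eq[OF sets_K] intro!: arg_cong2[where f = emeasure])
    show "(\<integral>\<^sup>+ (g, h). indicator B g * indicator C h * emeasure (Q h) A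
          \<partial>cond_law K (MG \<Otimes>\<^sub>M MH) (\<lambda>\<omega>. (G \<omega>, H \<omega>)) \<theta>) =
        (\<integral>\<^sup>+ x. indicator B (G (x, \<theta>)) * indicator C (H (x, \<theta>)) * emeasure (Q (H (x, \<theta>))) A
          \<partial>K \<theta>)"
      unfolding cond_law_def by (subst nn_integral_distr) simp_all
  qed
  show ?thesis
    unfolding trans_cond_indep_def
    by (intro ex_cong1 conj_cong[OF refl] ball_cong[OF refl] arg_cong2[where f = "(=)"])
       (rule law int; assumption)+
qed

text \<open>
  The heart of Basu's theorem.  The event \<open>E\<close> has the parameter-free probability \<open>p\<close>; completeness is
  applied to the centred conditional probability \<open>Q s E - p\<close>, which sufficiency makes a function
  of the statistic alone.
\<close>

lemma basu_product_rule:
  assumes K: "markov_kernel T X K"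
    and S: "S \<in> X \<rightarrow>\<^sub>M N"
    and Q: "markov_kernel N X Q"
    and disint: "\<And>\<theta> D. \<theta> \<in> space T \<Longrightarrow> D \<in> sets N \<Longrightarrow>
      emeasure (K \<theta>) {x \<in> space X. x \<in> E \<and> S x \<in> D} =
      (\<integral>\<^sup>+ x. indicator D (S x) * emeasure (Q (S x)) E \<partial>K \<theta>)"
    and complete: "boundedly_complete T K N (\<lambda>(x, \<theta>). S x)"
    and E: "E \<in> sets X"
    and p: "0 \<le> p"
    and const: "\<And>\<theta>. \<theta> \<in> space T \<Longrightarrow> emeasure (K \<theta>) E = ennreal p"
    and \<theta>: "\<theta> \<in> space T"
    and D: "D \<in> sets N"
  shows "emeasure (K \<theta>) {x \<in> space X. x \<in> E \<and> S x \<in> D} =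
    ennreal p * emeasure (K \<theta>) {x \<in> space X. S x \<in> D}"
proof -
  have K_prob: "prob_space (K t)" and sets_K: "sets (K t) = sets X" if "t \<in> space T" for t
    using measurable_space[OF K that] by (simp_all add: space_prob_algebra)
  have space_K: "space (K t) = space X" if "t \<in> space T" for t
    using sets_K[OF that] by (rule sets_eq_imp_space_eq)
  have S_K: "S \<in> K t \<rightarrow>\<^sub>M N" if "t \<in> space T" for t
    using S by (simp add: measurable_cong_sets[OF sets_K[OF that] refl])
  have Q_prob: "prob_space (Q s)" if "s \<in> space N" for s
    using measurable_space[OF Q that] by (simp add: space_prob_algebra)
  have Q_E: "(\<lambda>s. measure (Q s) E) \<in> borel_measurable N"
    using measurable_emeasure_kernel[OF measurable_prob_algebraD[OF Q] E]
    unfolding measure_def by measurable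
  have QS: "emeasure (Q (S x)) E = ennreal (measure (Q (S x)) E)" if "x \<in> space X" for x
  proof -
    interpret prob_space "Q (S x)"
      using Q_prob measurable_space[OF S that] .
    show ?thesis by (rule emeasure_eq_measure)
  qed
  define g where "g s = measure (Q s) E - p" for s
  have g_meas: "g \<in> borel_measurable N"
    unfolding g_def using Q_E by measurable
  have g_bound: "bounded (g ` space N)"
  proof (rule boundedI)
    fix y assume "y \<in> g ` space N"
    then obtain s where s: "s \<in> space N" "y = g s" by auto
    have "measure (Q s) E \<le> 1" using Q_prob[OF s(1)] by (rule prob_space.prob_le_1)
    then show "norm y \<le> 1 + \<bar>p\<bar>"
      using s(2) measure_nonneg[of "Q s" E] unfolding g_def real_norm_def by linarith
  qed
  \<comment> \<open>Taking the whole space for \<open>D\<close> in the disintegration is the law of total probability for \<open>E\<close>.\<close>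
  have g_mean: "(\<integral>s. g s \<partial>cond_law K N (\<lambda>(x, \<theta>). S x) t) = 0" if t: "t \<in> space T" for t
  proof -
    interpret prob_space "K t" by (rule K_prob[OF t])
    note [measurable] = S_K[OF t] Q_E
    have bound: "AE x in K t. norm (measure (Q (S x)) E) \<le> 1"
      using measurable_space[OF S_K[OF t]] Q_prob by (auto intro!: prob_space.prob_le_1)
    have integ: "integrable (K t) (\<lambda>x. measure (Q (S x)) E)"
      by (rule integrable_const_bound[OF bound]) measurable
    have "ennreal (prob E) = emeasure (K t) {x \<in> space X. x \<in> E \<and> S x \<in> space N}"
      unfolding emeasure_eq_measure[symmetric] using sets.sets_into_space[OF E] measurable_space[OF S]
      by (intro arg_cong2[where f = emeasure]) auto
    also have "\<dots> = (\<integral>\<^sup>+ x. indicator (space N) (S x) * emeasure (Q (S x)) E \<partial>K t)"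
      by (rule disint[OF t sets.top])
    also have "\<dots> = (\<integral>\<^sup>+ x. ennreal (measure (Q (S x)) E) \<partial>K t)"
      using measurable_space[OF S] by (intro nn_integral_cong) (simp add: QS space_K[OF t])
    also have "\<dots> = ennreal (\<integral>x. measure (Q (S x)) E \<partial>K t)"
      by (rule nn_integral_eq_integral[OF integ]) simp
    finally have mean: "(\<integral>x. measure (Q (S x)) E \<partial>K t) = prob E"
      by (simp add: integral_nonneg_AE)
    have "prob E = p" using const[OF t] p by (simp add: emeasure_eq_measure)
    then show ?thesis
      using g_meas integ mean
      by (simp add: cond_law_def integral_distr[OF S_K[OF t]] g_def prob_space)
  qed
  have "AE s in cond_law K N (\<lambda>(x, \<theta>). S x) \<theta>. g s = 0"
    using complete g_meas g_bound g_mean \<theta> unfolding boundedly_complete_def by blast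
  then have ae: "AE x in K \<theta>. measure (Q (S x)) E = p"
    using AE_distrD[OF S_K[OF \<theta>]] unfolding cond_law_def prod.case g_def by simp
  have "emeasure (K \<theta>) {x \<in> space X. x \<in> E \<and> S x \<in> D} =
      (\<integral>\<^sup>+ x. indicator D (S x) * emeasure (Q (S x)) E \<partial>K \<theta>)"
    by (rule disint[OF \<theta> D])
  also have "\<dots> = (\<integral>\<^sup>+ x. ennreal p * indicator {x \<in> space X. S x \<in> D} x \<partial>K \<theta>)"
    using ae by (intro nn_integral_cong_AE) (auto simp: QS space_K[OF \<theta>] indicator_def)
  also have "\<dots> = ennreal p * emeasure (K \<theta>) {x \<in> space X. S x \<in> D}"
    using S D by (intro nn_integral_cmult_indicator) (simp add: sets_K[OF \<theta>])
  finally show ?thesis .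
qed

theorem theorem4p5:
  fixes \<X> :: "'x measure" and \<U> :: "'u measure" and \<S> :: "'s measure" and \<T> :: "'t measure"
    and K :: "'t \<Rightarrow> 'x measure" and R :: "'x \<Rightarrow> 'u" and S :: "'x \<Rightarrow> 's"
  assumes "markov_kernel \<T> \<X> K"
    and "R \<in> \<X> \<rightarrow>\<^sub>M \<U>"
    and "S \<in> \<X> \<rightarrow>\<^sub>M \<S>"
    and ancillary: "trans_indep \<T> K \<U> (\<lambda>(x, \<theta>). R x) \<T> (\<lambda>(x, \<theta>). \<theta>)"
    and sufficient:
      "trans_cond_indep \<T> K \<X> (\<lambda>(x, \<theta>). x) \<T> (\<lambda>(x, \<theta>). \<theta>) \<S> (\<lambda>(x, \<theta>). S x)"
    and complete: "boundedly_complete \<T> K \<S> (\<lambda>(x, \<theta>). S x)"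
  shows "trans_indep \<T> K \<U> (\<lambda>(x, \<theta>). R x) (\<T> \<Otimes>\<^sub>M \<S>) (\<lambda>(x, \<theta>). (\<theta>, S x))"
proof -
  note K = assms(1) and R = assms(2) and S = assms(3)
  have K_prob: "prob_space (K \<theta>)" and sets_K: "sets (K \<theta>) = sets \<X>" if "\<theta> \<in> space \<T>" for \<theta>
    using measurable_space[OF K that] by (simp_all add: space_prob_algebra)
  have space_K: "space (K \<theta>) = space \<X>" if "\<theta> \<in> space \<T>" for \<theta>
    using sets_K[OF that] by (rule sets_eq_imp_space_eq)
  \<comment> \<open>The redexes display the maps on pairs that resolution below has to match.\<close>
  have section_R: "\<forall>\<theta>\<in>space \<T>. (\<lambda>x. (\<lambda>(x, \<theta>). R x) (x, \<theta>)) \<in> \<X> \<rightarrow>\<^sub>M \<U>"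
    and section_S: "\<forall>\<theta>\<in>space \<T>. (\<lambda>x. (\<lambda>(x, \<theta>). S x) (x, \<theta>)) \<in> \<X> \<rightarrow>\<^sub>M \<S>"
    and section_X: "\<forall>\<theta>\<in>space \<T>. (\<lambda>x. (\<lambda>(x, \<theta>). x) (x, \<theta>)) \<in> \<X> \<rightarrow>\<^sub>M \<X>"
    and section_unit: "\<forall>\<theta>\<in>space \<T>. (\<lambda>x. (\<lambda>_. ()) (x, \<theta>)) \<in> \<X> \<rightarrow>\<^sub>M count_space UNIV"
    and section_\<Theta>: "\<forall>\<theta>\<in>space \<T>. (\<lambda>x. (\<lambda>(x, \<theta>). \<theta>) (x, \<theta>)) \<in> \<X> \<rightarrow>\<^sub>M \<T>"
    and section_\<Theta>S: "\<forall>\<theta>\<in>space \<T>. (\<lambda>x. (\<lambda>(x, \<theta>). (\<theta>, S x)) (x, \<theta>)) \<in> \<X> \<rightarrow>\<^sub>M \<T> \<Otimes>\<^sub>M \<S>"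
    using R S by simp_all
  note independence_iff =
    trans_cond_indep_iff_sample_space[OF K, where F = "\<lambda>(x, \<theta>). R x" and H = "\<lambda>_. ()",
      OF section_R _ section_unit, unfolded prod.case]
  from iffD1[OF independence_iff[OF section_\<Theta>, unfolded prod.case] ancillary]
  obtain Q0 where Q0: "markov_kernel (count_space UNIV) \<U> Q0"
    and Q0_eq: "\<forall>\<theta>\<in>space \<T>. \<forall>A\<in>sets \<U>. \<forall>B\<in>sets \<T>. \<forall>C\<in>sets (count_space UNIV).
      emeasure (K \<theta>) {x \<in> space \<X>. R x \<in> A \<and> \<theta> \<in> B \<and> () \<in> C} =
      (\<integral>\<^sup>+ x. indicator B \<theta> * indicator C () * emeasure (Q0 ()) A \<partial>K \<theta>)"
    by (elim exE conjE)
  from iffD1[OF trans_cond_indep_iff_sample_space[OF K section_X section_\<Theta> section_S] sufficient,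
    unfolded prod.case]
  obtain Q where Q: "markov_kernel \<S> \<X> Q"
    and Q_eq: "\<forall>\<theta>\<in>space \<T>. \<forall>A\<in>sets \<X>. \<forall>B\<in>sets \<T>. \<forall>C\<in>sets \<S>.
      emeasure (K \<theta>) {x \<in> space \<X>. x \<in> A \<and> \<theta> \<in> B \<and> S x \<in> C} =
      (\<integral>\<^sup>+ x. indicator B \<theta> * indicator C (S x) * emeasure (Q (S x)) A \<partial>K \<theta>)"
    by (elim exE conjE)
  interpret q: prob_space "Q0 ()"
    using measurable_space[OF Q0] by (simp add: space_prob_algebra)
  have law_R: "emeasure (K \<theta>) (R -` A \<inter> space \<X>) = ennreal (q.prob A)"
    if "\<theta> \<in> space \<T>" "A \<in> sets \<U>" for \<theta> A
    using Q0_eq[rule_format, OF that sets.top, of UNIV]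
      prob_space.emeasure_space_1[OF K_prob[OF that(1)]] that
    by (simp add: q.emeasure_eq_measure vimage_def Int_def conj_commute)
  have disint: "emeasure (K \<theta>) {x \<in> space \<X>. x \<in> E \<and> S x \<in> D} =
      (\<integral>\<^sup>+ x. indicator D (S x) * emeasure (Q (S x)) E \<partial>K \<theta>)"
    if "\<theta> \<in> space \<T>" "E \<in> sets \<X>" "D \<in> sets \<S>" for \<theta> E D
    using Q_eq[rule_format, OF that(1,2) sets.top that(3)] that(1) by simp
  have product: "emeasure (K \<theta>) {x \<in> space \<X>. R x \<in> A \<and> (\<theta>, S x) \<in> B \<and> () \<in> C} =
      (\<integral>\<^sup>+ x. indicator B (\<theta>, S x) * indicator C () * emeasure (Q0 ()) A \<partial>K \<theta>)"
    if \<theta>: "\<theta> \<in> space \<T>" and A: "A \<in> sets \<U>" and B: "B \<in> sets (\<T> \<Otimes>\<^sub>M \<S>)" for \<theta> A B C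
  proof (cases "() \<in> C")
    case True
    \<comment> \<open>Sections of measurable sets are measurable even where singletons of parameters are not.\<close>
    let ?D = "Pair \<theta> -` B"
    have E: "R -` A \<inter> space \<X> \<in> sets \<X>" and D: "?D \<in> sets \<S>"
      using measurable_sets[OF R A] sets_Pair1[OF B] by auto
    have "emeasure (K \<theta>) {x \<in> space \<X>. R x \<in> A \<and> (\<theta>, S x) \<in> B \<and> () \<in> C} =
        emeasure (K \<theta>) {x \<in> space \<X>. x \<in> R -` A \<inter> space \<X> \<and> S x \<in> ?D}"
      using True by (intro arg_cong2[where f = emeasure]) auto
    also have "\<dots> = ennreal (q.prob A) * emeasure (K \<theta>) {x \<in> space \<X>. S x \<in> ?D}"
      using basu_product_rule[OF K S Q disint[OF _ E] complete E measure_nonneg law_R[OF _ A] \<theta> D] .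
    also have "\<dots> = (\<integral>\<^sup>+ x. ennreal (q.prob A) * indicator {x \<in> space \<X>. S x \<in> ?D} x \<partial>K \<theta>)"
      using measurable_sets[OF S D]
      by (intro nn_integral_cmult_indicator[symmetric])
         (simp add: sets_K[OF \<theta>] vimage_def Int_def conj_commute)
    also have "\<dots> = (\<integral>\<^sup>+ x. indicator B (\<theta>, S x) * indicator C () * emeasure (Q0 ()) A \<partial>K \<theta>)"
      using True
      by (intro nn_integral_cong) (simp add: space_K[OF \<theta>] q.emeasure_eq_measure indicator_def)
    finally show ?thesis .
  qed simp
  show ?thesis
    using Q0 product
    by (intro iffD2[OF independence_iff[OF section_\<Theta>S]] exI[of _ Q0] conjI ballI) simp_all
qed

end
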